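(* Let $m,n\ge 1$. The minimal number of generators of $H_{mn}$ as a closed group is $\max\{m+1,\,n+1\}$; that is, $\max\{m+1,n+1\}$ is the smallest cardinality of a subset $S\subseteq H_{mn}$ such that the subgroup generated by $S$ is dense in $H_{mn}$.
   Context: For integers $m,n\ge 1$, $H_{mn}=\mathbb{R}^{m-1}\times\mathbb{R}\times\mathbb{R}^n$ denotes the simply connected Lie group (with the usual manifold structure) with product $(v,a,\mathbf b)(v',a',\mathbf b')=(v+v',\,a+a',\,\mathbf b+e^{a}\mathbf b')$, where $v,v'\in\mathbb{R}^{m-1}$, $a,a'\in\mathbb{R}$, $\mathbf b,\mathbf b'\in\mathbb{R}^n$. *)

theory Defs
  imports "HOL-Analysis.Analysis" "HOL-Algebra.Generated_Groups"
begin

text \<open>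
  The underlying space is \<open>\<real>\<^sup>m\<^sup>-\<^sup>1 \<times> \<real> \<times> \<real>\<^sup>n\<close> with its usual topology.
  \<^const>\<open>Euclidean_space\<close>~\<open>k\<close> is the space of all \<open>x :: nat \<Rightarrow> real\<close> with \<open>x i = 0\<close> for
  \<open>i \<ge> k\<close>; for \<open>k = 0\<close> it is a single point, so \<open>m = 1\<close> is covered. The group is only
  intended for \<open>m \<ge> 1\<close>: the subtraction below is truncated.
\<close>

type_synonym H_point = "(nat \<Rightarrow> real) \<times> real \<times> (nat \<Rightarrow> real)"

definition H_topology :: "nat \<Rightarrow> nat \<Rightarrow> H_point topology" where
  "H_topology m n =
     prod_topology (Euclidean_space (m - 1)) (prod_topology euclideanreal (Euclidean_space n))"

definition H_group :: "nat \<Rightarrow> nat \<Rightarrow> H_point monoid" where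
  "H_group m n =
     \<lparr>carrier = topspace (H_topology m n),
      mult = (\<lambda>(v, a, b) (v', a', b').
        ((\<lambda>i. v i + v' i), a + a', (\<lambda>i. b i + exp a * b' i))),
      one = ((\<lambda>i. 0), 0, (\<lambda>i. 0))\<rparr>"

definition topologically_generates :: "'a monoid \<Rightarrow> 'a topology \<Rightarrow> 'a set \<Rightarrow> bool" where
  "topologically_generates G T S \<longleftrightarrow>
     S \<subseteq> carrier G \<and> T closure_of (generate G S) = topspace T"

text \<open>
  \<open>k\<close> is the smallest cardinality of a topologically generating set. Infinite sets, for
  which \<^const>\<open>card\<close> is \<open>0\<close> by convention, exceed every natural number \<open>k\<close> in cardinality,
  so only finite sets have to be compared with \<open>k\<close>.
\<close>

definition is_min_number_of_generators :: "'a monoid \<Rightarrow> 'a topology \<Rightarrow> nat \<Rightarrow> bool" where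
  "is_min_number_of_generators G T k \<longleftrightarrow>
     (\<exists>S. topologically_generates G T S \<and> finite S \<and> card S = k) \<and>
     (\<forall>S. topologically_generates G T S \<and> finite S \<longrightarrow> k \<le> card S)"

lemma carrier_H_group:
  "carrier (H_group m n) =
     {(v, a, b). (\<forall>i\<ge>m - 1. v i = 0) \<and> (\<forall>i\<ge>n. b i = 0)}"
  by (auto simp: H_group_def H_topology_def topspace_Euclidean_space)

lemma group_H_group: "group (H_group m n)"
proof (rule groupI)
  fix x assume x: "x \<in> carrier (H_group m n)"
  obtain v a b where xe: "x = (v, a, b)" by (cases x)
  show "\<exists>y\<in>carrier (H_group m n). y \<otimes>\<^bsub>H_group m n\<^esub> x = \<one>\<^bsub>H_group m n\<^esub>"
  proof (rule bexI)
    show "((\<lambda>i. - v i), - a, (\<lambda>i. - exp (- a) * b i)) \<otimes>\<^bsub>H_group m n\<^esub> x = \<one>\<^bsub>H_group m n\<^esub>"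
      by (simp add: xe H_group_def)
    show "((\<lambda>i. - v i), - a, (\<lambda>i. - exp (- a) * b i)) \<in> carrier (H_group m n)"
      using x by (simp add: xe carrier_H_group)
  qed
next
  fix x y assume "x \<in> carrier (H_group m n)" "y \<in> carrier (H_group m n)"
  then show "x \<otimes>\<^bsub>H_group m n\<^esub> y \<in> carrier (H_group m n)"
    unfolding carrier_H_group by (auto simp: H_group_def)
next
  show "\<one>\<^bsub>H_group m n\<^esub> \<in> carrier (H_group m n)"
    unfolding carrier_H_group by (simp add: H_group_def)
qed (auto simp: H_group_def algebra_simps exp_add split: prod.splits)

end

theory Submission
  imports Defs
begin

text \<open>
  Write a point of the group as \<open>h = (v, a, b)\<close>. The number of generators is forced from two
  sides, by the abelianisation \<open>\<real>\<^sup>m\<close>, in which \<open>h\<close> becomes \<open>(v, a)\<close>, and by the action of the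
  group on \<open>\<real>\<^sup>n\<close> through the affine maps \<open>x \<mapsto> exp a \<cdot> x + b\<close>.

  \<^bold>\<open>Lower bounds.\<close> Both bounds produce a proper closed subgroup containing \<open>S\<close>, and both find it by
  solving a homogeneous linear system that has one equation for each element of \<open>S\<close> and more unknowns
  than equations.
  \<^item> If \<open>card S \<le> n\<close>, some \<open>(c, s) \<noteq> 0\<close> in \<open>\<real>\<^sup>n \<times> \<real>\<close> makes \<open>F (v, a, b) = c \<bullet> b - (exp a - 1) s\<close>
    vanish on \<open>S\<close>. As \<open>F (h h') = F h + exp a \<cdot> F h'\<close>, the zero set of \<open>F\<close> is a closed subgroup.
    (For \<open>c \<noteq> 0\<close> it consists of the elements whose affine map preserves the hyperplane
    \<open>c \<bullet> x + s = 0\<close>; for \<open>c = 0\<close> it is the subgroup \<open>a = 0\<close> of translations.)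
  \<^item> If \<open>card S \<le> m\<close>, some \<open>(c, t) \<noteq> 0\<close> in \<open>\<real>\<^sup>m \<times> \<real>\<close> makes the homomorphism
    \<open>f h = c \<bullet> (v, a)\<close> constant on \<open>S\<close> with value \<open>t\<close>. Then \<open>f\<close> maps the group generated by \<open>S\<close> into
    the discrete group \<open>t\<int>\<close>, whose preimage is a closed subgroup.

  \<^bold>\<open>Upper bound.\<close> Take \<open>(0, 1, 0)\<close> together with \<open>max m n\<close> elements whose \<open>b\<close>-parts exhaust the unit
  vectors of \<open>\<real>\<^sup>n\<close> and whose images in \<open>\<real>\<^sup>m\<close> are the other unit vectors and one vector \<open>\<theta>\<close> whose
  coordinates are linearly independent together with \<open>1\<close> over the integers. By Kronecker's theorem
  the images generate a dense subgroup of \<open>\<real>\<^sup>m\<close>. The commutator of \<open>(0, 1, 0)\<close> with an element \<open>(v, a, b)\<close> is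
  \<open>(0, 0, (exp 1 - 1) b)\<close>, and repeated conjugation by the inverse of \<open>(0, 1, 0)\<close>
  shrinks it towards \<open>0\<close>; so the generated group contains arbitrarily small multiples of all unit vectors of the normal
  subgroup \<open>\<real>\<^sup>n\<close> and is dense there. Density in the normal subgroup and in the quotient
  gives density in the whole group.
\<close>

section \<open>Homogeneous linear systems\<close>

text \<open>
  Gaussian elimination: an equation with a nonzero coefficient at \<open>p\<close> is solved for the
  unknown \<open>p\<close>, which is then removed from the other equations.
\<close>

lemma underdetermined_homogeneous_system:
  fixes w :: "'a \<Rightarrow> 'b \<Rightarrow> real"
  assumes "finite A" "finite I" "card A < card I"
  shows "\<exists>c. (\<exists>i\<in>I. c i \<noteq> 0) \<and> (\<forall>a\<in>A. (\<Sum>i\<in>I. w a i * c i) = 0)"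
  using assms
proof (induction A arbitrary: I w rule: finite_induct)
  case empty
  then have "I \<noteq> {}" by auto
  then show ?case by (intro exI[of _ "\<lambda>_. 1"]) auto
next
  case (insert a A)
  show ?case
  proof (cases "\<forall>i\<in>I. w a i = 0")
    case True
    have "card A < card I" using insert by simp
    with insert.IH[OF insert.prems(1), of w] obtain c where
      "\<exists>i\<in>I. c i \<noteq> 0" "\<forall>a\<in>A. (\<Sum>i\<in>I. w a i * c i) = 0" by blast
    with True show ?thesis by (intro exI[of _ c]) simp
  next
    case False
    then obtain p where p: "p \<in> I" "w a p \<noteq> 0" by blast
    define J where "J = I - {p}"
    have J: "finite J" "p \<notin> J" "I = insert p J" using insert.prems p by (auto simp: J_def)
    have "card A < card J" using insert J by simp
    with insert.IH[OF J(1), of "\<lambda>x i. w x i - w x p * w a i / w a p"] obtain c where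
      c: "\<exists>i\<in>J. c i \<noteq> 0"
         "\<And>x. x \<in> A \<Longrightarrow> (\<Sum>i\<in>J. (w x i - w x p * w a i / w a p) * c i) = 0" by blast
    define r where "r = - (\<Sum>i\<in>J. w a i * c i) / w a p"
    define d where "d = c(p := r)"
    have sum_d: "(\<Sum>i\<in>I. w x i * d i) = w x p * r + (\<Sum>i\<in>J. w x i * c i)" for x
    proof -
      have "(\<Sum>i\<in>J. w x i * d i) = (\<Sum>i\<in>J. w x i * c i)"
        using J by (intro sum.cong) (auto simp: d_def)
      then show ?thesis using J by (simp add: d_def)
    qed
    have "(\<Sum>i\<in>I. w a i * d i) = 0"
      using p by (simp add: sum_d r_def)
    moreover have "(\<Sum>i\<in>I. w x i * d i) = 0" if "x \<in> A" for x
    proof -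
      have "(\<Sum>i\<in>J. (w x i - w x p * w a i / w a p) * c i)
          = (\<Sum>i\<in>J. w x i * c i) - w x p / w a p * (\<Sum>i\<in>J. w a i * c i)"
        by (simp add: sum_distrib_left sum_subtractf left_diff_distrib algebra_simps)
      then show ?thesis using c(2)[OF that] by (simp add: sum_d r_def)
    qed
    moreover have "\<exists>i\<in>I. d i \<noteq> 0" using c(1) J by (auto simp: d_def)
    ultimately show ?thesis by (intro exI[of _ d]) auto
  qed
qed

section \<open>The group and its topology\<close>

lemma H_mult:
  "(v, a, b) \<otimes>\<^bsub>H_group m n\<^esub> (v', a', b') =
     ((\<lambda>i. v i + v' i), a + a', (\<lambda>i. b i + exp a * b' i))"
  by (simp add: H_group_def)

lemma H_one: "\<one>\<^bsub>H_group m n\<^esub> = ((\<lambda>i. 0), 0, (\<lambda>i. 0))"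
  by (simp add: H_group_def)

lemma H_inv:
  assumes "(v, a, b) \<in> carrier (H_group m n)"
  shows "inv\<^bsub>H_group m n\<^esub> (v, a, b) = ((\<lambda>i. - v i), - a, (\<lambda>i. - exp (- a) * b i))"
proof -
  interpret group "H_group m n" by (rule group_H_group)
  show ?thesis
    by (rule inv_equality) (use assms in \<open>auto simp: H_mult H_one carrier_H_group\<close>)
qed

lemma carrier_H_group_eq_topspace: "carrier (H_group m n) = topspace (H_topology m n)"
  by (simp add: H_group_def)

lemma continuous_map_Euclidean_space_coordinate:
  "continuous_map (Euclidean_space k) euclideanreal (\<lambda>x. x i)"
  unfolding Euclidean_space_def
  by (rule continuous_map_from_subtopology) (metis UNIV_I continuous_map_product_coordinates)

lemma continuous_map_H_coordinates:
  shows "continuous_map (H_topology m n) euclideanreal (\<lambda>h. fst h i)"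
    and "continuous_map (H_topology m n) euclideanreal (\<lambda>h. fst (snd h))"
    and "continuous_map (H_topology m n) euclideanreal (\<lambda>h. snd (snd h) i)"
proof -
  have "continuous_map (H_topology m n) euclideanreal ((\<lambda>x. x i) \<circ> fst)"
    unfolding H_topology_def
    by (rule continuous_map_compose[OF continuous_map_fst continuous_map_Euclidean_space_coordinate])
  then show "continuous_map (H_topology m n) euclideanreal (\<lambda>h. fst h i)" by (simp add: o_def)
  have "continuous_map (H_topology m n) euclideanreal (fst \<circ> snd)"
    unfolding H_topology_def
    by (rule continuous_map_compose[OF continuous_map_snd continuous_map_fst])
  then show "continuous_map (H_topology m n) euclideanreal (\<lambda>h. fst (snd h))" by (simp add: o_def)
  have "continuous_map (H_topology m n) euclideanreal ((\<lambda>x. x i) \<circ> (snd \<circ> snd))"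
    unfolding H_topology_def
    by (rule continuous_map_compose[OF
          continuous_map_compose[OF continuous_map_snd continuous_map_snd]
          continuous_map_Euclidean_space_coordinate])
  then show "continuous_map (H_topology m n) euclideanreal (\<lambda>h. snd (snd h) i)" by (simp add: o_def)
qed

lemma open_in_Euclidean_space_imp_coordinate_box:
  assumes U: "openin (Euclidean_space k) U" "x \<in> U"
  shows "\<exists>e>0. \<forall>y\<in>topspace (Euclidean_space k). (\<forall>i<k. \<bar>y i - x i\<bar> < e) \<longrightarrow> y \<in> U"
proof -
  obtain V where V: "openin (powertop_real UNIV) V" "U = V \<inter> {x. \<forall>i\<ge>k. x i = 0}"
    using U by (auto simp: Euclidean_space_def openin_subtopology)
  then obtain X where X: "\<And>i. open (X i)" "x \<in> Pi\<^sub>E UNIV X" "Pi\<^sub>E UNIV X \<subseteq> V"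
    using U by (auto simp: openin_product_topology_alt) metis
  have "\<exists>e>0. \<forall>z. \<bar>z - x i\<bar> < e \<longrightarrow> z \<in> X i" for i
    using X(1)[of i] X(2) by (auto simp: open_dist dist_real_def PiE_iff)
  then obtain e where e: "\<And>i. e i > 0" "\<And>i z. \<bar>z - x i\<bar> < e i \<Longrightarrow> z \<in> X i" by metis
  define d where "d = Min (insert 1 (e ` {..<k}))"
  have "d > 0" using e by (auto simp: d_def)
  have d: "d \<le> e i" if "i < k" for i using that by (auto simp: d_def)
  have "y \<in> U" if y: "y \<in> topspace (Euclidean_space k)" "\<forall>i<k. \<bar>y i - x i\<bar> < d" for y
  proof -
    have "y i \<in> X i" for i
    proof (cases "i < k")
      case True
      then show ?thesis using e(2) d y(2) by (meson less_le_trans)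
    next
      case False
      then have "y i = x i" using y(1) U V by (auto simp: topspace_Euclidean_space)
      then show ?thesis using X(2) by auto
    qed
    then have "y \<in> V" using X(3) by (auto simp: PiE_iff)
    then show ?thesis using V y(1) by (auto simp: topspace_Euclidean_space)
  qed
  with \<open>d > 0\<close> show ?thesis by blast
qed

lemma H_dense_if_coordinatewise_approximable:
  assumes K: "K \<subseteq> carrier (H_group m n)"
    and approx: "\<And>v a b e. e > 0 \<Longrightarrow>
      \<exists>v' a' b'. (v', a', b') \<in> K \<and> (\<forall>i<m - 1. \<bar>v' i - v i\<bar> < e) \<and> \<bar>a' - a\<bar> < e \<and>
        (\<forall>i<n. \<bar>b' i - b i\<bar> < e)"
  shows "H_topology m n closure_of K = topspace (H_topology m n)"
proof
  show "H_topology m n closure_of K \<subseteq> topspace (H_topology m n)"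
    by (rule closure_of_subset_topspace)
  show "topspace (H_topology m n) \<subseteq> H_topology m n closure_of K"
  proof
    fix h assume h: "h \<in> topspace (H_topology m n)"
    obtain v a b where hv: "h = (v, a, b)" by (cases h)
    have "\<exists>y\<in>K. y \<in> T" if T: "h \<in> T" "openin (H_topology m n) T" for T
    proof -
      have "\<exists>U W. openin (Euclidean_space (m - 1)) U \<and>
          openin (prod_topology euclideanreal (Euclidean_space n)) W \<and>
          v \<in> U \<and> (a, b) \<in> W \<and> U \<times> W \<subseteq> T"
        by (rule iffD1[OF openin_prod_topology_alt, rule_format, OF T(2)[unfolded H_topology_def]])
          (use T(1) hv in simp)
      then obtain U W where UW: "openin (Euclidean_space (m - 1)) U" "v \<in> U"
          "openin (prod_topology euclideanreal (Euclidean_space n)) W" "(a, b) \<in> W" "U \<times> W \<subseteq> T"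
        by blast
      have "\<exists>A B. openin euclideanreal A \<and> openin (Euclidean_space n) B \<and>
          a \<in> A \<and> b \<in> B \<and> A \<times> B \<subseteq> W"
        using UW(3)[unfolded openin_prod_topology_alt, rule_format, OF UW(4)] .
      then obtain A B where AB: "open A" "a \<in> A" "openin (Euclidean_space n) B" "b \<in> B" "A \<times> B \<subseteq> W"
        by (auto simp del: openin_prod_Times_iff)
      obtain e1 where e1: "e1 > 0" "\<forall>y\<in>topspace (Euclidean_space (m - 1)).
          (\<forall>i<m - 1. \<bar>y i - v i\<bar> < e1) \<longrightarrow> y \<in> U"
        using open_in_Euclidean_space_imp_coordinate_box[OF UW(1,2)] by blast
      obtain e2 where e2: "e2 > 0" "\<forall>y\<in>topspace (Euclidean_space n).
          (\<forall>i<n. \<bar>y i - b i\<bar> < e2) \<longrightarrow> y \<in> B"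
        using open_in_Euclidean_space_imp_coordinate_box[OF AB(3,4)] by blast
      obtain e3 where e3: "e3 > 0" "\<forall>y. \<bar>y - a\<bar> < e3 \<longrightarrow> y \<in> A"
        using AB(1,2) by (auto simp: open_dist dist_real_def)
      obtain v' a' b' where y: "(v', a', b') \<in> K" "\<forall>i<m - 1. \<bar>v' i - v i\<bar> < min e1 (min e2 e3)"
          "\<bar>a' - a\<bar> < min e1 (min e2 e3)" "\<forall>i<n. \<bar>b' i - b i\<bar> < min e1 (min e2 e3)"
        using approx[of "min e1 (min e2 e3)" v a b] e1(1) e2(1) e3(1) by auto
      have "v' \<in> U" "b' \<in> B" "a' \<in> A"
        using y K e1 e2 e3 by (auto simp: carrier_H_group topspace_Euclidean_space)
      then show ?thesis using y(1) UW(5) AB(5) by blast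
    qed
    with h show "h \<in> H_topology m n closure_of K" by (auto simp: closure_of_def)
  qed
qed

section \<open>Lower bounds\<close>

lemma closed_subgroup_containing_topological_generators:
  assumes "group G" "topologically_generates G T S"
    and "subgroup A G" "closedin T A" "S \<subseteq> A"
  shows "topspace T \<subseteq> A"
proof -
  have "generate G S \<subseteq> A" using assms group.generate_subgroup_incl by blast
  then have "T closure_of (generate G S) \<subseteq> A" using assms(4) by (rule closure_of_minimal)
  then show ?thesis using assms(2) by (simp add: topologically_generates_def)
qed

text \<open>
  The unknowns \<open>c 0, \<dots>, c (n - 1)\<close> are the coefficients of \<open>b\<close> and \<open>c n\<close> plays the part of \<open>s\<close> in
  the twisted homomorphism \<open>F = c \<bullet> b - (exp a - 1) s\<close>. Were \<open>F\<close> zero everywhere,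
  its values at \<open>(0, 0, e\<^sub>i)\<close> and \<open>(0, 1, 0)\<close> would kill all unknowns.
\<close>

lemma H_generators_gt_dim_b:
  assumes gen: "topologically_generates (H_group m n) (H_topology m n) S" and fin: "finite S"
  shows "n < card S"
proof (rule ccontr)
  assume "\<not> n < card S"
  then have "card S < card {..<Suc n}" by simp
  from underdetermined_homogeneous_system[OF fin _ this,
      of "\<lambda>h i. if i < n then snd (snd h) i else - (exp (fst (snd h)) - 1)"]
  obtain c where c: "\<exists>i<Suc n. c i \<noteq> 0" and
    cS: "\<And>h. h \<in> S \<Longrightarrow> (\<Sum>i<Suc n. (if i < n then snd (snd h) i
                           else - (exp (fst (snd h)) - 1)) * c i) = 0"
    by auto
  define F where "F h = (\<Sum>i<n. snd (snd h) i * c i) - (exp (fst (snd h)) - 1) * c n" for h :: H_point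
  define A where "A = {h \<in> topspace (H_topology m n). F h \<in> {0}}"
  have FS: "F h = 0" if "h \<in> S" for h
    using cS[OF that] by (simp add: F_def algebra_simps)
  have F_mult: "F (h \<otimes>\<^bsub>H_group m n\<^esub> h') = F h + exp (fst (snd h)) * F h'" for h h'
    by (cases h; cases h')
      (simp add: H_mult F_def sum.distrib sum_distrib_left algebra_simps exp_add)
  interpret group "H_group m n" by (rule group_H_group)
  have "subgroup A (H_group m n)"
  proof (rule subgroupI)
    show "A \<subseteq> carrier (H_group m n)" by (auto simp: A_def carrier_H_group_eq_topspace)
    have "\<one>\<^bsub>H_group m n\<^esub> \<in> A"
      using one_closed by (simp add: A_def F_def H_one carrier_H_group_eq_topspace)
    then show "A \<noteq> {}" by blast
  next
    fix h assume h: "h \<in> A"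
    then have hc: "h \<in> carrier (H_group m n)" by (simp add: A_def carrier_H_group_eq_topspace)
    have "F (h \<otimes>\<^bsub>H_group m n\<^esub> inv\<^bsub>H_group m n\<^esub> h) = 0"
      using hc by (simp add: F_def H_one)
    then have "F (inv\<^bsub>H_group m n\<^esub> h) = 0" using h by (simp add: F_mult A_def)
    then show "inv\<^bsub>H_group m n\<^esub> h \<in> A"
      using inv_closed[OF hc] by (simp add: A_def carrier_H_group_eq_topspace)
  next
    fix h h' assume "h \<in> A" "h' \<in> A"
    then show "h \<otimes>\<^bsub>H_group m n\<^esub> h' \<in> A"
      using m_closed[of h h'] by (simp add: A_def F_mult carrier_H_group_eq_topspace)
  qed
  moreover have "continuous_map (H_topology m n) euclideanreal (\<lambda>h. exp (fst (snd h)))"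
    using continuous_map_compose[OF continuous_map_H_coordinates(2), of euclideanreal exp]
    by (simp add: o_def continuous_on_exp)
  then have "continuous_map (H_topology m n) euclideanreal F"
    unfolding F_def
    by (intro continuous_intros continuous_map_H_coordinates) auto
  then have "closedin (H_topology m n) A"
    unfolding A_def by (rule closedin_continuous_map_preimage) simp
  moreover have "S \<subseteq> A"
    using gen FS by (auto simp: A_def topologically_generates_def carrier_H_group_eq_topspace)
  ultimately have all: "carrier (H_group m n) \<subseteq> A"
    using closed_subgroup_containing_topological_generators[OF group_H_group gen]
    by (simp add: carrier_H_group_eq_topspace)
  have "c i = 0" if "i < n" for i
  proof -
    have "((\<lambda>_. 0), 0, (\<lambda>j. if j = i then 1 else 0)) \<in> A"
      using all that by (auto simp: carrier_H_group)
    then show ?thesis using that by (simp add: A_def F_def if_distrib[of "\<lambda>x. x * _"] cong: if_cong)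
  qed
  moreover have "c n = 0"
  proof -
    have "((\<lambda>_. 0), 1, (\<lambda>_. 0)) \<in> A" using all by (auto simp: carrier_H_group)
    then show ?thesis by (simp add: A_def F_def)
  qed
  ultimately show False using c by (auto simp: less_Suc_eq)
qed

text \<open>
  The unknowns are the coefficients \<open>c 0, \<dots>, c (m - 2)\<close> of \<open>v\<close>, the coefficient \<open>c (m - 1)\<close> of \<open>a\<close>,
  and the common value \<open>t = c m\<close> on \<open>S\<close>. If the functional is nonzero, it attains all
  real values, hence also one outside \<open>t\<int>\<close>; if it is zero, then \<open>t \<noteq> 0\<close>, so that \<open>S\<close> would
  have to be empty.
\<close>

lemma H_generators_gt_dim_abelianisation:
  assumes m: "m \<ge> 1" and gen: "topologically_generates (H_group m n) (H_topology m n) S"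
    and fin: "finite S"
  shows "m < card S"
proof (rule ccontr)
  obtain p where p: "m = Suc p" using m by (cases m) auto
  assume "\<not> m < card S"
  then have "card S < card {..<Suc (Suc p)}" by (simp add: p)
  from underdetermined_homogeneous_system[OF fin _ this,
      of "\<lambda>h i. if i < p then fst h i else if i = p then fst (snd h) else - 1"]
  obtain c where c: "\<exists>i<Suc (Suc p). c i \<noteq> 0" and
    cS: "\<And>h. h \<in> S \<Longrightarrow> (\<Sum>i<Suc (Suc p). (if i < p then fst h i else if i = p then fst (snd h)
                           else - 1) * c i) = 0"
    by auto
  define t where "t = c (Suc p)"
  define f where "f h = (\<Sum>i<p. fst h i * c i) + fst (snd h) * c p" for h :: H_point
  define A where "A = {h \<in> topspace (H_topology m n). f h \<in> (*\<^sub>R) t ` \<int>}"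
  have fS: "f h = t" if "h \<in> S" for h
    using cS[OF that] by (simp add: f_def t_def)
  have f_mult: "f (h \<otimes>\<^bsub>H_group m n\<^esub> h') = f h + f h'" for h h'
    by (cases h; cases h') (simp add: H_mult f_def sum.distrib algebra_simps)
  interpret group "H_group m n" by (rule group_H_group)
  have "subgroup A (H_group m n)"
  proof (rule subgroupI)
    show "A \<subseteq> carrier (H_group m n)" by (auto simp: A_def carrier_H_group_eq_topspace)
    have "\<one>\<^bsub>H_group m n\<^esub> \<in> A"
      using one_closed by (auto simp: A_def f_def H_one carrier_H_group_eq_topspace image_iff
          intro!: bexI[of _ 0])
    then show "A \<noteq> {}" by blast
  next
    fix h assume h: "h \<in> A"
    then have hc: "h \<in> carrier (H_group m n)" by (simp add: A_def carrier_H_group_eq_topspace)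
    obtain k where k: "k \<in> \<int>" "f h = t * k" using h by (auto simp: A_def)
    have "f (h \<otimes>\<^bsub>H_group m n\<^esub> inv\<^bsub>H_group m n\<^esub> h) = 0"
      using hc by (simp add: f_def H_one)
    then have "f (inv\<^bsub>H_group m n\<^esub> h) = t *\<^sub>R (- k)" using k by (simp add: f_mult)
    then show "inv\<^bsub>H_group m n\<^esub> h \<in> A"
      using inv_closed[OF hc] k(1) unfolding A_def carrier_H_group_eq_topspace
      by (blast intro: Ints_minus)
  next
    fix h h' assume h: "h \<in> A" "h' \<in> A"
    then obtain k k' where "k \<in> \<int>" "f h = t * k" "k' \<in> \<int>" "f h' = t * k'"
      by (auto simp: A_def)
    then have "f (h \<otimes>\<^bsub>H_group m n\<^esub> h') = t *\<^sub>R (k + k')" "k + k' \<in> \<int>"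
      by (auto simp: f_mult algebra_simps)
    then show "h \<otimes>\<^bsub>H_group m n\<^esub> h' \<in> A"
      using m_closed[of h h'] h unfolding A_def carrier_H_group_eq_topspace by blast
  qed
  moreover have "continuous_map (H_topology m n) euclideanreal f"
    unfolding f_def
    by (intro continuous_intros continuous_map_H_coordinates) auto
  then have "closedin (H_topology m n) A"
    unfolding A_def
    by (rule closedin_continuous_map_preimage) (use closed_scaling[OF closed_Ints, of t] in \<open>simp only: closed_closedin\<close>)
  moreover have "S \<subseteq> A"
    using gen fS by (auto simp: A_def topologically_generates_def carrier_H_group_eq_topspace
        image_iff intro!: bexI[of _ 1])
  ultimately have all: "carrier (H_group m n) \<subseteq> A"
    using closed_subgroup_containing_topological_generators[OF group_H_group gen]
    by (simp add: carrier_H_group_eq_topspace)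
  define r where "r = (if t = 0 then 1 else t / 2)"
  have r: "r \<notin> (*\<^sub>R) t ` \<int>"
  proof
    assume "r \<in> (*\<^sub>R) t ` \<int>"
    then obtain k :: int where k: "r = t * of_int k" by (auto elim: Ints_cases)
    then have "t \<noteq> 0" by (auto simp: r_def)
    with k have "2 * real_of_int k = 1" by (simp add: r_def)
    then have "2 * k = 1" by linarith
    then show False by presburger
  qed
  have "c i = 0" if "i < p" for i
  proof (rule ccontr)
    assume "c i \<noteq> 0"
    have "((\<lambda>j. if j = i then r / c i else 0), 0, (\<lambda>_. 0)) \<in> A"
      using all that by (auto simp: carrier_H_group p)
    then have "r \<in> (*\<^sub>R) t ` \<int>" using that \<open>c i \<noteq> 0\<close>
      by (simp add: A_def f_def if_distrib[of "\<lambda>x. x * _"] cong: if_cong)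
    with r show False by blast
  qed
  moreover have "c p = 0"
  proof (rule ccontr)
    assume "c p \<noteq> 0"
    have "((\<lambda>_. 0), r / c p, (\<lambda>_. 0)) \<in> A"
      using all by (auto simp: carrier_H_group)
    then have "r \<in> (*\<^sub>R) t ` \<int>" using \<open>c p \<noteq> 0\<close> by (simp add: A_def f_def)
    with r show False by blast
  qed
  ultimately have "t \<noteq> 0" "\<And>h. f h = 0"
    using c by (auto simp: less_Suc_eq t_def f_def)
  moreover have "S \<noteq> {}" using H_generators_gt_dim_b[OF gen fin] by auto
  ultimately show False using fS by fastforce
qed

section \<open>A dense subgroup of a real coordinate space\<close>

text \<open>
  For fixed \<open>N\<close> only countably many integer coefficient vectors occur, and each nonzero one
  excludes finitely many \<open>t\<close>.
\<close>

lemma ex_real_not_root_of_int_polynomials: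
  "\<exists>t::real. \<forall>c::nat \<Rightarrow> int. (\<Sum>i\<le>N. of_int (c i) * t ^ i) = 0 \<longrightarrow> (\<forall>i\<le>N. c i = 0)"
proof -
  define C where "C = {c \<in> Pi\<^sub>E {..N} (\<lambda>_. UNIV :: int set). \<exists>i\<le>N. c i \<noteq> 0}"
  define R where "R = (\<Union>c\<in>C. {t::real. (\<Sum>i\<le>N. of_int (c i) * t ^ i) = 0})"
  have "countable (Pi\<^sub>E {..N} (\<lambda>_. UNIV :: int set))" by (rule countable_PiE) auto
  then have "countable C" by (rule countable_subset[rotated]) (auto simp: C_def)
  moreover have "countable {t::real. (\<Sum>i\<le>N. of_int (c i) * t ^ i) = 0}" if "c \<in> C" for c
  proof -
    have "\<exists>i\<le>N. real_of_int (c i) \<noteq> 0" using that by (auto simp: C_def)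
    then have "finite {t::real. (\<Sum>i\<le>N. of_int (c i) * t ^ i) = 0}"
      using polyfun_finite_roots[of "\<lambda>i. real_of_int (c i)" N] by blast
    then show ?thesis by (rule countable_finite)
  qed
  ultimately have "countable R" unfolding R_def by (rule countable_UN)
  then have "R \<noteq> UNIV" using uncountable_UNIV_real by metis
  then obtain t where t: "t \<notin> R" by blast
  have "\<forall>i\<le>N. c i = 0" if "(\<Sum>i\<le>N. of_int (c i) * t ^ i) = 0" for c :: "nat \<Rightarrow> int"
  proof (rule ccontr)
    assume "\<not> (\<forall>i\<le>N. c i = 0)"
    then have "restrict c {..N} \<in> C" by (auto simp: C_def)
    moreover have "(\<Sum>i\<le>N. of_int (restrict c {..N} i) * t ^ i) = 0" using that by simp
    ultimately show False using t unfolding R_def by blast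
  qed
  then show ?thesis by blast
qed

text \<open>
  The coordinates of \<open>\<theta>\<close> are powers of the number just found, in descending order, because
  Kronecker's theorem expects the entry \<open>1\<close> at the last index.
\<close>

lemma ex_vector_dense_multiples_mod_int:
  "\<exists>\<theta>::nat \<Rightarrow> real. \<forall>\<alpha> e. e > 0 \<longrightarrow>
     (\<exists>(k::int) (q::nat \<Rightarrow> int). \<forall>i<N. \<bar>of_int k * \<theta> i - of_int (q i) - \<alpha> i\<bar> < e)"
proof -
  obtain t :: real where t: "\<And>c::nat \<Rightarrow> int. (\<Sum>i\<le>N. of_int (c i) * t ^ i) = 0 \<Longrightarrow> \<forall>i\<le>N. c i = 0"
    using ex_real_not_root_of_int_polynomials[of N] by blast
  define \<theta> where "\<theta> i = t ^ (N - i)" for i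
  interpret Modules.module "\<lambda>r x. real_of_int r * x"
    by (simp add: Modules.module.intro distrib_left mult.commute)
  have inj_pow: "inj_on (\<lambda>i. t ^ i) {..N}"
  proof (rule inj_onI, rule ccontr)
    fix i j assume ij: "i \<in> {..N}" "j \<in> {..N}" "t ^ i = t ^ j" "i \<noteq> j"
    define c :: "nat \<Rightarrow> int" where "c k = (if k = i then 1 else 0) - (if k = j then 1 else 0)" for k
    have "(\<Sum>k\<le>N. of_int (c k) * t ^ k)
        = (\<Sum>k\<le>N. (if k = i then t ^ k else 0) - (if k = j then t ^ k else 0))"
      by (intro sum.cong) (auto simp: c_def)
    also have "\<dots> = 0" using ij by (simp add: sum_subtractf)
    finally have "c i = 0" using t[of c] ij by blast
    then show False using ij by (simp add: c_def)
  qed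
  have image: "\<theta> ` {..N} = (\<lambda>i. t ^ i) ` {..N}"
  proof -
    have "(\<lambda>i. N - i) ` {..N} = {..N}"
      by (auto simp: image_iff) (metis atMost_iff diff_diff_cancel diff_le_self)
    then show ?thesis
      unfolding \<theta>_def using image_image[of "\<lambda>i. t ^ i" "\<lambda>i. N - i" "{..N}"] by simp
  qed
  have "inj_on \<theta> {..N}"
    using inj_pow unfolding inj_on_def \<theta>_def
    by (metis atMost_iff diff_diff_cancel diff_le_self)
  moreover have "independent (\<theta> ` {..N})"
    unfolding image independent_explicit_module
  proof (intro allI impI)
    fix B u v
    assume B: "finite B" "B \<subseteq> (\<lambda>i. t ^ i) ` {..N}" "(\<Sum>v\<in>B. real_of_int (u v) * v) = 0" "v \<in> B"
    define c where "c i = (if t ^ i \<in> B then u (t ^ i) else 0)" for i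
    have "(\<Sum>i\<le>N. of_int (c i) * t ^ i)
        = (\<Sum>x\<in>(\<lambda>i. t ^ i) ` {..N}. real_of_int (if x \<in> B then u x else 0) * x)"
      using inj_pow by (simp add: sum.reindex c_def)
    also have "\<dots> = (\<Sum>x\<in>B. real_of_int (u x) * x)"
      using B by (intro sum.mono_neutral_cong_right) auto
    finally have c0: "\<forall>i\<le>N. c i = 0" using B t by simp
    obtain i where "i \<le> N" "v = t ^ i" using B by auto
    with c0 B(4) show "u v = 0" by (auto simp: c_def split: if_splits)
  qed
  moreover have "\<theta> N = 1" by (simp add: \<theta>_def)
  ultimately have "\<exists>(k::int) (q::nat \<Rightarrow> int). \<forall>i<N. \<bar>of_int k * \<theta> i - of_int (q i) - \<alpha> i\<bar> < e"
    if "e > 0" for \<alpha> e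
    using Kronecker_thm_2[of \<theta> N e \<alpha>] that by metis
  then show ?thesis by blast
qed

definition additive_subgroup :: "(nat \<Rightarrow> real) set \<Rightarrow> bool" where
  "additive_subgroup L \<longleftrightarrow> (\<lambda>_. 0) \<in> L \<and> (\<forall>x\<in>L. (\<lambda>i. - x i) \<in> L) \<and>
     (\<forall>x\<in>L. \<forall>y\<in>L. (\<lambda>i. x i + y i) \<in> L)"

lemma additive_subgroup_int_multiple:
  assumes L: "additive_subgroup L" and x: "x \<in> L"
  shows "(\<lambda>i. of_int k * x i) \<in> L"
proof -
  have nat: "(\<lambda>i. of_nat j * x i) \<in> L" for j :: nat
  proof (induction j)
    case 0
    then show ?case using L by (simp add: additive_subgroup_def)
  next
    case (Suc j)
    then have "(\<lambda>i. of_nat j * x i + x i) \<in> L" using L x by (simp add: additive_subgroup_def)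
    then show ?case by (simp add: algebra_simps)
  qed
  show ?thesis
  proof (cases k)
    case (nonneg j)
    then show ?thesis using nat[of j] by simp
  next
    case (neg j)
    have "(\<lambda>i. - (of_nat (Suc j) * x i)) \<in> L"
      using bspec[OF _ nat[of "Suc j"], of "\<lambda>x. (\<lambda>i. - x i) \<in> L"] L
      by (simp add: additive_subgroup_def)
    moreover have "(\<lambda>i. - (of_nat (Suc j) * x i)) = (\<lambda>i. of_int k * x i)"
      unfolding neg by (intro ext) (simp add: algebra_simps)
    ultimately show ?thesis by simp
  qed
qed

lemma additive_subgroup_assemble_coordinates:
  assumes L: "additive_subgroup L" and x: "\<And>i. i < k \<Longrightarrow> (\<lambda>j. if j = i then x i else 0) \<in> L"
  shows "(\<lambda>j. if j < k then x j else 0) \<in> L"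
  using x
proof (induction k)
  case 0
  then show ?case using L by (simp add: additive_subgroup_def)
next
  case (Suc k)
  then have "(\<lambda>j. (if j < k then x j else 0) + (if j = k then x k else 0)) \<in> L"
    using L by (simp add: additive_subgroup_def)
  moreover have "(\<lambda>j. (if j < k then x j else 0) + (if j = k then x k else 0))
      = (\<lambda>j. if j < Suc k then x j else 0)" by (auto simp: less_Suc_eq)
  ultimately show ?case by simp
qed

section \<open>A generating set of the required size\<close>

text \<open>
  Here \<open>p = m - 1\<close>. The hypotheses list what a subgroup must contain for the density argument:
  \<open>(0, 1, 0)\<close> for contraction, elements over the unit vectors and over \<open>\<theta>\<close> in the abelianisation
  (whose last coordinate is \<open>a\<close>), and elements with the unit vectors of \<open>\<real>\<^sup>n\<close> as \<open>b\<close>-parts.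
\<close>

lemma H_subgroup_dense:
  assumes K: "subgroup K (H_group (Suc p) n)"
    and dil: "((\<lambda>_. 0), 1, (\<lambda>_. 0)) \<in> K"
    and unit: "\<And>i. i < p \<Longrightarrow> \<exists>b. ((\<lambda>j. if j = i then 1 else 0), 0, b) \<in> K"
    and \<theta>: "\<exists>b. ((\<lambda>j. if j < p then \<theta> j else 0), \<theta> p, b) \<in> K"
    and dense: "\<And>\<alpha> e. e > 0 \<Longrightarrow>
     \<exists>(k::int) (q::nat \<Rightarrow> int). \<forall>i<Suc p. \<bar>of_int k * \<theta> i - of_int (q i) - \<alpha> i\<bar> < e"
    and trans: "\<And>i. i < n \<Longrightarrow> \<exists>v a. (v, a, (\<lambda>j. if j = i then 1 else 0)) \<in> K"
  shows "H_topology (Suc p) n closure_of K = topspace (H_topology (Suc p) n)"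
proof (rule H_dense_if_coordinatewise_approximable)
  show Kc: "K \<subseteq> carrier (H_group (Suc p) n)" using K by (rule subgroup.subset)
  have mult: "((\<lambda>i. v i + v' i), a + a', (\<lambda>i. b i + exp a * b' i)) \<in> K"
    if "(v, a, b) \<in> K" "(v', a', b') \<in> K" for v a b v' a' b'
    using subgroup.m_closed[OF K that] by (simp add: H_mult)
  have inv: "((\<lambda>i. - v i), - a, (\<lambda>i. - exp (- a) * b i)) \<in> K" if "(v, a, b) \<in> K" for v a b
    using subgroup.m_inv_closed[OF K that] that Kc by (simp add: H_inv subset_iff)
  have one: "((\<lambda>_. 0), 0, (\<lambda>_. 0)) \<in> K" using subgroup.one_closed[OF K] by (simp add: H_one)

  define P where "P = {x. \<exists>b. ((\<lambda>i. if i < p then x i else 0), x p, b) \<in> K}"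
  have P: "additive_subgroup P"
    unfolding additive_subgroup_def
  proof (intro conjI ballI)
    show "(\<lambda>_. 0) \<in> P" using one by (auto simp: P_def)
  next
    fix x assume "x \<in> P"
    then obtain b where "((\<lambda>i. if i < p then x i else 0), x p, b) \<in> K" by (auto simp: P_def)
    from inv[OF this] have
      "((\<lambda>i. if i < p then - x i else 0), - x p, (\<lambda>i. - exp (- x p) * b i)) \<in> K"
      by (simp add: if_distrib[of uminus] cong: if_cong)
    then show "(\<lambda>i. - x i) \<in> P" unfolding P_def by blast
  next
    fix x y assume "x \<in> P" "y \<in> P"
    then obtain b b' where "((\<lambda>i. if i < p then x i else 0), x p, b) \<in> K"
      "((\<lambda>i. if i < p then y i else 0), y p, b') \<in> K" by (auto simp: P_def)
    from mult[OF this] have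
      "((\<lambda>i. (if i < p then x i else 0) + (if i < p then y i else 0)), x p + y p,
         (\<lambda>i. b i + exp (x p) * b' i)) \<in> K" .
    moreover have "(\<lambda>i. (if i < p then x i else 0) + (if i < p then y i else 0))
       = (\<lambda>i. if i < p then x i + y i else 0)" by auto
    ultimately show "(\<lambda>i. x i + y i) \<in> P" unfolding P_def by auto
  qed
  have P_unit: "(\<lambda>j. if j = i then 1 else 0) \<in> P" if "i < Suc p" for i
  proof (cases "i = p")
    case True
    have "(\<lambda>j. if j < p then if j = p then 1 else 0 else 0) = (\<lambda>_. 0::real)" by auto
    then show ?thesis using True dil by (auto simp: P_def)
  next
    case False
    then have "(\<lambda>j. if j < p then if j = i then 1 else 0 else 0) = (\<lambda>j. if j = i then 1 else 0::real)"
      using that by auto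
    then show ?thesis using False unit[of i] that by (auto simp: P_def)
  qed
  have P_\<theta>: "\<theta> \<in> P" using \<theta> by (simp add: P_def)
  have P_dense: "\<exists>x\<in>P. \<forall>i<Suc p. \<bar>x i - \<alpha> i\<bar> < e" if e: "e > 0" for \<alpha> e
  proof -
    obtain k :: int and q :: "nat \<Rightarrow> int"
      where kq: "\<forall>i<Suc p. \<bar>of_int k * \<theta> i - of_int (q i) - \<alpha> i\<bar> < e"
      using dense[OF e, of \<alpha>] by blast
    have "(\<lambda>j. if j = i then of_int (- q i) else 0) \<in> P" if "i < Suc p" for i
      using additive_subgroup_int_multiple[OF P P_unit[OF that], of "- q i"]
      by (simp add: if_distrib cong: if_cong)
    then have "(\<lambda>j. if j < Suc p then of_int (- q j) else 0) \<in> P"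
      by (rule additive_subgroup_assemble_coordinates[OF P])
    moreover have "(\<lambda>j. of_int k * \<theta> j) \<in> P"
      by (rule additive_subgroup_int_multiple[OF P P_\<theta>])
    ultimately have "(\<lambda>j. of_int k * \<theta> j + (if j < Suc p then of_int (- q j) else 0)) \<in> P"
      using P by (simp add: additive_subgroup_def)
    then show ?thesis
      by (rule rev_bexI) (use kq in simp)
  qed

  define N where "N = {b. ((\<lambda>_. 0), 0, b) \<in> K}"
  have N: "additive_subgroup N"
    unfolding additive_subgroup_def N_def
    using one inv[where v = "\<lambda>_. 0" and a = 0]
      mult[where v = "\<lambda>_. 0" and v' = "\<lambda>_. 0" and a = 0 and a' = 0] by simp
  \<comment> \<open>Conjugation by the inverse of \<open>(0, 1, 0)\<close>.\<close>
  have contract: "(\<lambda>i. exp (- 1) * x i) \<in> N" if "x \<in> N" for x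
    using mult[OF mult[OF inv[OF dil]], of "\<lambda>_. 0" 0 x, OF _ dil] that
    by (simp add: N_def)
  have contracted: "(\<lambda>i. exp (- real k) * x i) \<in> N" if "x \<in> N" for k x
  proof (induction k)
    case 0
    then show ?case using that by simp
  next
    case (Suc k)
    from contract[OF this] show ?case by (simp add: exp_diff exp_minus field_simps)
  qed
  have N_unit: "(\<lambda>j. if j = i then exp 1 - 1 else 0) \<in> N" if "i < n" for i
  proof -
    obtain v a where h: "(v, a, (\<lambda>j. if j = i then 1 else 0)) \<in> K" using trans[OF \<open>i < n\<close>] by blast
    \<comment> \<open>The commutator of \<open>(0, 1, 0)\<close> with this element.\<close>
    from mult[OF mult[OF mult[OF dil h] inv[OF dil]] inv[OF h]]
    have "(\<lambda>j. exp 1 * (if j = i then 1 else 0)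
             - exp a * (exp (- a) * (if j = i then 1 else 0))) \<in> N"
      by (simp add: N_def)
    moreover have "(\<lambda>j. exp 1 * (if j = i then 1 else 0)
             - exp a * (exp (- a) * (if j = i then 1 else 0)))
         = (\<lambda>j. if j = i then exp 1 - 1 else 0)"
      by (auto simp: exp_minus)
    ultimately show ?thesis by simp
  qed
  have N_dense: "\<exists>y\<in>N. \<forall>i<n. \<bar>y i - b i\<bar> < e" if "e > 0" for b e
  proof -
    have "((\<lambda>k. exp (- real k) * (exp 1 - 1)) \<longlongrightarrow> 0) sequentially" by real_asymp
    then have "\<forall>\<^sub>F k in sequentially. exp (- real k) * (exp 1 - 1) < e"
      using order_tendstoD(2) that by blast
    then obtain k where k: "exp (- real k) * (exp 1 - 1) < e"
      by (auto simp: eventually_sequentially)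
    define d where "d = exp (- real k) * (exp 1 - 1 :: real)"
    have d: "0 < d" "d < e" using k by (auto simp: d_def)
    define y where "y i = of_int \<lfloor>b i / d\<rfloor> * d" for i
    have y: "\<bar>y i - b i\<bar> < e" for i
    proof -
      have "y i \<le> b i"
        unfolding y_def using d(1) of_int_floor_le[of "b i / d"] by (simp only: pos_le_divide_eq)
      moreover have "b i < y i + d"
        using d(1) floor_correct[of "b i / d"] by (simp add: y_def pos_divide_less_eq algebra_simps)
      ultimately show ?thesis using d by linarith
    qed
    have "(\<lambda>j. if j = i then y i else 0) \<in> N" if "i < n" for i
    proof -
      have "(\<lambda>j. of_int \<lfloor>b i / d\<rfloor> * (exp (- real k) * (if j = i then exp 1 - 1 else 0))) \<in> N"
        by (rule additive_subgroup_int_multiple[OF N contracted[OF N_unit[OF that]]])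
      moreover have "(\<lambda>j. of_int \<lfloor>b i / d\<rfloor> * (exp (- real k) * (if j = i then exp 1 - 1 else 0)))
         = (\<lambda>j. if j = i then y i else 0)" by (auto simp: y_def d_def)
      ultimately show ?thesis by simp
    qed
    then have "(\<lambda>j. if j < n then y j else 0) \<in> N"
      by (rule additive_subgroup_assemble_coordinates[OF N])
    then show ?thesis by (rule rev_bexI) (use y in simp)
  qed

  fix v a b and e :: real assume "e > 0"
  obtain x where x: "x \<in> P" "\<forall>i<Suc p. \<bar>x i - (if i < p then v i else a)\<bar> < e"
    using P_dense[OF \<open>e > 0\<close>, of "\<lambda>i. if i < p then v i else a"] by blast
  then obtain b' where b': "((\<lambda>i. if i < p then x i else 0), x p, b') \<in> K" by (auto simp: P_def)
  obtain y where y: "y \<in> N" "\<forall>i<n. \<bar>y i - (b i - b' i)\<bar> < e" 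
    using N_dense[OF \<open>e > 0\<close>, of "\<lambda>i. b i - b' i"] by blast
  have "((\<lambda>i. if i < p then x i else 0), x p, (\<lambda>i. y i + b' i)) \<in> K"
    using mult[of "\<lambda>_. 0" 0 y, OF _ b'] y(1) by (simp add: N_def)
  moreover have "\<forall>i<n. \<bar>y i + b' i - b i\<bar> < e" using y(2) by (simp add: algebra_simps)
  moreover have "\<forall>i<p. \<bar>x i - v i\<bar> < e" "\<bar>x p - a\<bar> < e" using x(2) by (auto simp: less_Suc_eq)
  ultimately show "\<exists>v' a' b'. (v', a', b') \<in> K \<and> (\<forall>i<Suc p - 1. \<bar>v' i - v i\<bar> < e) \<and>
      \<bar>a' - a\<bar> < e \<and> (\<forall>i<n. \<bar>b' i - b i\<bar> < e)"
    by (intro exI[of _ "\<lambda>i. if i < p then x i else 0"] exI[of _ "x p"]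
        exI[of _ "\<lambda>i. y i + b' i"]) auto
qed

text \<open>
  The same index \<open>i\<close> serves both factors: \<open>g i\<close> carries the \<open>i\<close>-th unit vector as its \<open>b\<close>-part and
  one of the required vectors as its image in the abelianisation, and whichever list is the
  shorter one is padded with zeros. Only an upper bound for the cardinality is recorded; equality
  comes from the lower bounds.
\<close>

lemma H_ex_generators:
  assumes m: "m \<ge> 1"
  shows "\<exists>S. topologically_generates (H_group m n) (H_topology m n) S \<and> finite S \<and>
    card S \<le> Suc (max m n)"
proof -
  obtain p where p: "m = Suc p" using m by (cases m) auto
  obtain \<theta> :: "nat \<Rightarrow> real" where \<theta>: "\<And>\<alpha> e. e > 0 \<Longrightarrow>
     \<exists>(k::int) (q::nat \<Rightarrow> int). \<forall>i<Suc p. \<bar>of_int k * \<theta> i - of_int (q i) - \<alpha> i\<bar> < e"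
    using ex_vector_dense_multiples_mod_int[of "Suc p"] by blast
  define g :: "nat \<Rightarrow> H_point" where
    "g i = ((\<lambda>j. if j < p then if i < p then if j = i then 1 else 0
                   else if i = p then \<theta> j else 0 else 0),
            if i = p then \<theta> p else 0,
            (\<lambda>j. if i < n \<and> j = i then 1 else 0))" for i
  define d :: H_point where "d = ((\<lambda>_. 0), 1, (\<lambda>_. 0))"
  define S where "S = insert d (g ` {..<max m n})"
  define K where "K = generate (H_group m n) S"
  interpret group "H_group m n" by (rule group_H_group)
  have S: "S \<subseteq> carrier (H_group m n)"
    by (auto simp: S_def g_def d_def carrier_H_group p)
  have K: "subgroup K (H_group (Suc p) n)"
    using generate_is_subgroup[OF S] by (simp add: K_def p)
  have gK: "g i \<in> K" if "i < max m n" for i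
    using that by (auto simp: K_def S_def intro: generate.incl)
  have "H_topology (Suc p) n closure_of K = topspace (H_topology (Suc p) n)"
  proof (rule H_subgroup_dense[OF K _ _ _ \<theta>])
    show "((\<lambda>_. 0), 1, (\<lambda>_. 0)) \<in> K"
      unfolding d_def[symmetric] by (auto simp: K_def S_def intro: generate.incl)
  next
    fix i assume i: "i < p"
    then have "g i = ((\<lambda>j. if j = i then 1 else 0), 0, (\<lambda>j. if i < n \<and> j = i then 1 else 0))"
      by (auto simp: g_def)
    moreover have "g i \<in> K" using gK[of i] i by (simp add: p max_def)
    ultimately show "\<exists>b. ((\<lambda>j. if j = i then 1 else 0), 0, b) \<in> K" by auto
  next
    show "\<exists>b. ((\<lambda>j. if j < p then \<theta> j else 0), \<theta> p, b) \<in> K"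
    proof -
      have "g p = ((\<lambda>j. if j < p then \<theta> j else 0), \<theta> p, (\<lambda>j. if p < n \<and> j = p then 1 else 0))"
        by (auto simp: g_def)
      moreover have "g p \<in> K" using gK[of p] by (simp add: p less_max_iff_disj)
      ultimately show ?thesis by auto
    qed
  next
    fix i assume i: "i < n"
    then show "\<exists>v a. (v, a, (\<lambda>j. if j = i then 1 else 0)) \<in> K"
    proof -
      have "g i \<in> K" using gK[of i] i by (simp add: less_max_iff_disj)
      with i show ?thesis by (auto simp: g_def)
    qed
  qed
  then have "topologically_generates (H_group m n) (H_topology m n) S"
    using S by (simp add: topologically_generates_def K_def p)
  moreover have "finite S" by (simp add: S_def)
  moreover have "card S \<le> Suc (max m n)"
  proof -
    have "card (g ` {..<max m n}) \<le> max m n"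
      using card_image_le[of "{..<max m n}" g] by simp
    then show ?thesis
      unfolding S_def using card_insert_le_m1[of "Suc (max m n)" "g ` {..<max m n}" d] by simp
  qed
  ultimately show ?thesis by blast
qed

theorem proposition4p4:
  fixes m n :: nat
  assumes "m \<ge> 1" and "n \<ge> 1"
  shows "is_min_number_of_generators (H_group m n) (H_topology m n) (max (m + 1) (n + 1))"
proof -
  have lower: "max (m + 1) (n + 1) \<le> card S"
    if "topologically_generates (H_group m n) (H_topology m n) S" "finite S" for S
    using H_generators_gt_dim_abelianisation[OF assms(1) that] H_generators_gt_dim_b[OF that]
    by simp
  obtain S where S: "topologically_generates (H_group m n) (H_topology m n) S" "finite S"
      "card S \<le> Suc (max m n)"
    using H_ex_generators[OF assms(1)] by blast
  have "card S = max (m + 1) (n + 1)"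
    using lower[OF S(1,2)] S(3) by simp
  with S lower show ?thesis
    unfolding is_min_number_of_generators_def by blast
qed

end
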